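(* Let $a,b,c,z\in\mathbb{C}$ with $-c\notin\mathbb{N}\cup\{0\}$. Then $$F^2(a,b;c;z)=\sum_{n=0}^\infty u_n z^n,\qquad |z|<1,$$ with $u_0=1$, $u_1=2ab/c$ and $$u_{n+1}=\alpha_0(n)u_n+\alpha_1(n)u_{n-1},\qquad n\ge 1,$$ where $$\alpha_0(n)=\frac{2n^3+3(a+b+c-1)n^2+\big((a+b)(4c-3)+4ab-c+1\big)n+2ab(2c-1)}{(n+1)(c+n)(2c+n-1)},$$ $$\alpha_1(n)=-\frac{(2a+n-1)(2b+n-1)(a+b+n-1)}{(n+1)(c+n)(2c+n-1)}.$$
   Context: $F(a,b;c;z)=\sum_{k=0}^\infty \frac{(a)_k(b)_k}{(c)_k\,k!}z^k$ for $|z|<1$, $-c\notin\mathbb{N}\cup\{0\}$, is the Gaussian hypergeometric function, where $(x)_k=x(x+1)\cdots(x+k-1)$, $(x)_0=1$. $F^2(a,b;c;z)$ means $(F(a,b;c;z))^2$.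
   Formalization: The recurrence is asserted only for those n ≥ 1 with 2c+n−1 ≠ 0; otherwise (e.g. c = −1/2, n = 2) the denominators of α₀(n) and α₁(n) vanish and the coefficients are undefined. The expansion and initial values are asserted for all c with −c ∉ ℕ∪{0}. *)

theory Defs
  imports "HOL-Analysis.Analysis"
begin

text \<open>
  The Gaussian hypergeometric function; it is only meant for \<open>norm z < 1\<close> and \<open>- c \<notin> \<nat>\<close>
  (in Isabelle, \<open>0 \<in> \<nat>\<close>).
\<close>
definition gauss_F :: "complex \<Rightarrow> complex \<Rightarrow> complex \<Rightarrow> complex \<Rightarrow> complex" where
  "gauss_F a b c z =
     (\<Sum>k. pochhammer a k * pochhammer b k / (pochhammer c k * fact k) * z ^ k)"

lemma gauss_F_eq_eval_fps_hypergeo: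
  "gauss_F a b c z = eval_fps (fps_hypergeo [a, b] [c] 1) z"
  by (simp add: gauss_F_def eval_fps_def mult.commute)

text \<open>
  For \<open>- c \<notin> \<nat>\<close> and \<open>n \<ge> 1\<close> the denominator below vanishes exactly when \<open>2 * c = 1 - n\<close>, e.g. for
  \<open>c = - 1 / 2\<close> and \<open>n = 2\<close>. The coefficients are then undefined on paper but \<open>0\<close> here, so the
  recurrence must only be used at those \<open>n\<close> with \<open>2 * c + n - 1 \<noteq> 0\<close>.
\<close>
definition alpha0 :: "complex \<Rightarrow> complex \<Rightarrow> complex \<Rightarrow> nat \<Rightarrow> complex" where
  "alpha0 a b c n =
     (2 * of_nat n ^ 3 + 3 * (a + b + c - 1) * of_nat n ^ 2
        + ((a + b) * (4 * c - 3) + 4 * a * b - c + 1) * of_nat n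
        + 2 * a * b * (2 * c - 1))
     / ((of_nat n + 1) * (c + of_nat n) * (2 * c + of_nat n - 1))"

definition alpha1 :: "complex \<Rightarrow> complex \<Rightarrow> complex \<Rightarrow> nat \<Rightarrow> complex" where
  "alpha1 a b c n =
     - (((2 * a + of_nat n - 1) * (2 * b + of_nat n - 1) * (a + b + of_nat n - 1))
        / ((of_nat n + 1) * (c + of_nat n) * (2 * c + of_nat n - 1)))"

end

theory Submission
  imports Defs
begin

text \<open>
  Write \<open>F\<close> for the power series of \<open>F(a,b;c;\<cdot>)\<close>, and put \<open>P = X (1 - X)\<close>,
  \<open>L = c - (a + b + 1) X\<close> and \<open>t = a b\<close>. The series satisfies Gauss's equation
  \<open>P F'' + L F' = t F\<close>, so its square \<open>Y = F\<^sup>2\<close> satisfies the symmetric square of that equation,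
  which has order three. It is convenient to write this as two equations of lower order, by means of
  \<open>W = 2 P F'\<^sup>2\<close>:
  \<open>W = P Y'' + L Y' - 2 t Y\<close> and \<open>P W' = (P' - 2 L) W + 2 t P Y'\<close>.
  All the polynomial coefficients have degree at most two and \<open>P\<close> is divisible by \<open>X\<close>.
  Hence the first equation expresses \<open>W\<^sub>n\<close> by \<open>Y\<^sub>n\<^sub>+\<^sub>1\<close> and \<open>Y\<^sub>n\<close>, and the second links
  \<open>W\<^sub>n\<close>, \<open>W\<^sub>n\<^sub>-\<^sub>1\<close>, \<open>Y\<^sub>n\<close> and \<open>Y\<^sub>n\<^sub>-\<^sub>1\<close>; eliminating \<open>W\<close> leaves three consecutive coefficients of
  \<open>Y\<close>. After division by \<open>(n + 1) (c + n) (2 c + n - 1)\<close> this is the recurrence claimed.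
  (The factorisation of \<open>alpha1\<close> comes from
  \<open>(m + 2 \<sigma>) (m (m + \<sigma>) + 2 t) + 2 t m = (m + \<sigma>) (m + 2 a) (m + 2 b)\<close> with \<open>\<sigma> = a + b\<close> and
  \<open>m = n - 1\<close>.)

  By the ratio test the radius of convergence of \<open>F\<close> is at least one, so that in the unit disc the
  formal square of the series sums to the square of the function.
\<close>

section \<open>Gauss's differential equation for the formal series\<close>

lemma fps_hypergeo_2_1_rec:
  fixes a b c :: "'a::field_char_0"
  assumes "c + of_nat n \<noteq> 0"
  shows "(of_nat n + 1) * (c + of_nat n) * fps_nth (fps_hypergeo [a, b] [c] 1) (Suc n) =
           (a + of_nat n) * (b + of_nat n) * fps_nth (fps_hypergeo [a, b] [c] 1) n"
proof -
  have "of_nat n + 1 \<noteq> (0::'a)"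
    by (metis of_nat_neq_0 of_nat_Suc add.commute)
  with assms show ?thesis
    by (simp add: fps_hypergeo_rec divide_simps add.commute del: fps_hypergeo_nth)
qed

text \<open>
  The coefficient of \<open>X\<^sup>n\<close> in the equation is the recurrence above. The summand \<open>n (n - 1) F\<^sub>n\<close> of
  \<open>X\<^sup>2 F''\<close> comes out uniformly in \<open>n\<close> only after the split into \<open>n = 0\<close>, \<open>n = 1\<close> and \<open>n \<ge> 2\<close>,
  because subtraction on \<open>nat\<close> is truncated.
\<close>
lemma fps_hypergeo_2_1_ode:
  fixes a b c :: "'a::field_char_0"
  assumes "- c \<notin> \<nat>"
  defines "F \<equiv> fps_hypergeo [a, b] [c] 1"
  shows "fps_X * (1 - fps_X) * fps_deriv (fps_deriv F) +
           (fps_const c - fps_const (a + b + 1) * fps_X) * fps_deriv F = fps_const (a * b) * F"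
proof (rule fps_ext)
  fix n
  have "c + of_nat n \<noteq> 0"
    using assms(1) by (metis add.inverse_unique of_nat_in_Nats)
  then have rec: "(of_nat n + 1) * (c + of_nat n) * fps_nth F (Suc n) =
      (a + of_nat n) * (b + of_nat n) * fps_nth F n"
    unfolding F_def by (rule fps_hypergeo_2_1_rec)
  have expand: "fps_X * (1 - fps_X) * fps_deriv (fps_deriv F) +
           (fps_const c - fps_const (a + b + 1) * fps_X) * fps_deriv F =
       fps_X * fps_deriv (fps_deriv F) - fps_X * (fps_X * fps_deriv (fps_deriv F)) +
       fps_const c * fps_deriv F - fps_const (a + b + 1) * (fps_X * fps_deriv F)"
    by (simp only: algebra_simps mult_1_left mult_1_right)
  consider "n = 0" | "n = 1" | m where "n = Suc (Suc m)"
    by (metis One_nat_def not0_implies_Suc)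
  then show "fps_nth (fps_X * (1 - fps_X) * fps_deriv (fps_deriv F) +
           (fps_const c - fps_const (a + b + 1) * fps_X) * fps_deriv F) n =
        fps_nth (fps_const (a * b) * F) n"
  proof cases
    case 1
    with rec show ?thesis
      unfolding expand by (simp add: algebra_simps)
  next
    case 2
    with rec show ?thesis
      unfolding expand by (simp add: algebra_simps)
  next
    case 3
    with rec show ?thesis
      unfolding expand by (simp add: algebra_simps)
  qed
qed

section \<open>The symmetric square\<close>

text \<open>
  Both equations follow from \<open>Y' = 2 F F'\<close>, \<open>Y'' = 2 F'\<^sup>2 + 2 F F''\<close> and
  \<open>W' = 2 P' F'\<^sup>2 + 4 P F' F''\<close> when \<open>P F''\<close> is replaced by \<open>T F - L F'\<close>. Taking \<open>W\<close>
  as an auxiliary unknown keeps \<open>F''\<close> from being differentiated, so neither \<open>L'\<close> nor \<open>T'\<close> occurs and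
  nothing is divided by \<open>P\<close>, which is not invertible as a power series in Gauss's case.
\<close>
lemma fps_symmetric_square:
  fixes F P L T :: "'a::comm_ring_1 fps"
  assumes ode: "P * fps_deriv (fps_deriv F) + L * fps_deriv F = T * F"
  defines "Y \<equiv> F ^ 2" and "W \<equiv> 2 * P * fps_deriv F ^ 2"
  shows "W = P * fps_deriv (fps_deriv Y) + L * fps_deriv Y - 2 * T * Y"
    and "P * fps_deriv W = (fps_deriv P - 2 * L) * W + 2 * T * P * fps_deriv Y"
proof -
  have Y': "fps_deriv Y = 2 * F * fps_deriv F"
    by (simp add: Y_def power2_eq_square algebra_simps)
  have Y'': "fps_deriv (fps_deriv Y) = 2 * fps_deriv F ^ 2 + 2 * F * fps_deriv (fps_deriv F)"
    unfolding Y' by (simp add: power2_eq_square algebra_simps)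
  have W': "fps_deriv W =
      2 * fps_deriv P * fps_deriv F ^ 2 + 4 * P * fps_deriv F * fps_deriv (fps_deriv F)"
    by (simp add: W_def power2_eq_square algebra_simps)
  have "P * fps_deriv (fps_deriv Y) + L * fps_deriv Y - 2 * T * Y =
      W + 2 * F * (P * fps_deriv (fps_deriv F) + L * fps_deriv F - T * F)"
    unfolding Y'' Y' unfolding W_def Y_def by (simp add: algebra_simps power2_eq_square)
  then show "W = P * fps_deriv (fps_deriv Y) + L * fps_deriv Y - 2 * T * Y"
    by (simp add: ode)
  have "P * fps_deriv W = (fps_deriv P - 2 * L) * W + 2 * T * P * fps_deriv Y +
      4 * P * fps_deriv F * (P * fps_deriv (fps_deriv F) + L * fps_deriv F - T * F)"
    unfolding W' Y' unfolding W_def by (simp add: algebra_simps power2_eq_square)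
  then show "P * fps_deriv W = (fps_deriv P - 2 * L) * W + 2 * T * P * fps_deriv Y"
    by (simp add: ode)
qed

text \<open>
  With \<open>n = m + 1\<close>, comparison of the coefficients of \<open>X\<^sup>n\<close> in the second equation of the symmetric
  square gives
  \<open>(m + 2 c) W\<^sub>m\<^sub>+\<^sub>1 = (m + 2 (a + b)) W\<^sub>m + 2 a b ((m + 1) Y\<^sub>m\<^sub>+\<^sub>1 - m Y\<^sub>m)\<close>,
  and the first equation turns this into a relation between \<open>Y\<^sub>m\<close>, \<open>Y\<^sub>m\<^sub>+\<^sub>1\<close> and \<open>Y\<^sub>m\<^sub>+\<^sub>2\<close>. The
  factor \<open>m + 2 c\<close> is the source of the denominator \<open>2 c + n - 1\<close>. In the form without division, the
  relation persists where that factor vanishes: there it constrains the two earlier coefficients.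
\<close>
lemma hypergeo_square_rec:
  fixes a b c :: "'a::field_char_0"
  assumes "- c \<notin> \<nat>" and "n \<ge> 1"
  defines "u \<equiv> fps_nth (fps_hypergeo [a, b] [c] 1 ^ 2)"
  shows "(of_nat n + 1) * (c + of_nat n) * (2 * c + of_nat n - 1) * u (n + 1) =
      (2 * of_nat n ^ 3 + 3 * (a + b + c - 1) * of_nat n ^ 2
        + ((a + b) * (4 * c - 3) + 4 * a * b - c + 1) * of_nat n
        + 2 * a * b * (2 * c - 1)) * u n
      - (2 * a + of_nat n - 1) * (2 * b + of_nat n - 1) * (a + b + of_nat n - 1) * u (n - 1)"
proof -
  define F where "F = fps_hypergeo [a, b] [c] 1"
  define P :: "'a fps" where "P = fps_X * (1 - fps_X)"
  define L where "L = fps_const c - fps_const (a + b + 1) * fps_X"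
  define T where "T = fps_const (a * b)"
  define Y where "Y = F ^ 2"
  define W where "W = 2 * P * fps_deriv F ^ 2"
  have ode: "P * fps_deriv (fps_deriv F) + L * fps_deriv F = T * F"
    unfolding P_def L_def T_def F_def by (rule fps_hypergeo_2_1_ode[OF assms(1)])
  note eqs = fps_symmetric_square[OF ode, folded Y_def W_def]
  \<comment> \<open>Coefficients can be read off once every summand is a constant times powers of \<open>X\<close> times a series.\<close>
  have W_eq: "W = fps_X * fps_deriv (fps_deriv Y) - fps_X * (fps_X * fps_deriv (fps_deriv Y)) +
      fps_const c * fps_deriv Y - fps_const (a + b + 1) * (fps_X * fps_deriv Y)
      - fps_const (2 * a * b) * Y"
  proof -
    have "2 * T = fps_const (2 * a * b)"
      by (simp add: T_def fps_numeral_fps_const)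
    then show ?thesis
      by (simp only: eqs(1) P_def L_def) (simp only: algebra_simps mult_1_left mult_1_right)
  qed
  have W_nth: "fps_nth W k = (of_nat k + 1) * (c + of_nat k) * fps_nth Y (k + 1)
      - (of_nat k * (of_nat k - 1) + (a + b + 1) * of_nat k + 2 * a * b) * fps_nth Y k" for k
  proof -
    consider "k = 0" | "k = 1" | m where "k = Suc (Suc m)"
      by (metis One_nat_def not0_implies_Suc)
    then show ?thesis
      unfolding W_eq by cases (simp_all add: algebra_simps)
  qed
  have W'_eq: "fps_X * fps_deriv W - fps_X * (fps_X * fps_deriv W) =
      fps_const (1 - 2 * c) * W + fps_const (2 * (a + b)) * (fps_X * W)
      + fps_const (2 * a * b) * (fps_X * fps_deriv Y)
      - fps_const (2 * a * b) * (fps_X * (fps_X * fps_deriv Y))"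
  proof -
    have T2: "2 * T = fps_const (2 * a * b)"
      by (simp add: T_def fps_numeral_fps_const)
    have P': "fps_deriv P - 2 * L = fps_const (1 - 2 * c) + fps_const (2 * (a + b)) * fps_X"
      unfolding P_def L_def
      by (simp add: algebra_simps fps_numeral_fps_const
          flip: fps_const_add fps_const_sub fps_const_mult)
    show ?thesis
      using eqs(2)[unfolded P' T2]
      by (simp only: P_def algebra_simps mult_1_left mult_1_right)
  qed
  obtain m where n: "n = Suc m"
    using assms(2) by (cases n) auto
  have "(of_nat m + 2 * c) * fps_nth W (Suc m) =
      (of_nat m + 2 * (a + b)) * fps_nth W m
      + 2 * a * b * ((of_nat m + 1) * fps_nth Y (Suc m) - of_nat m * fps_nth Y m)"
    using arg_cong[OF W'_eq, of "\<lambda>G. fps_nth G (Suc m)"]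
    by (cases m) (simp_all add: algebra_simps)
  then show ?thesis
    unfolding W_nth n u_def F_def[symmetric] Y_def[symmetric]
    by (simp add: algebra_simps power2_eq_square power3_eq_cube)
qed

section \<open>Convergence in the unit disc\<close>

text \<open>
  The quotient of consecutive terms tends to \<open>r < 1\<close>. The form of the ratio test that asks for a bound
  on \<open>norm (f (Suc n))\<close>, not for a limit of quotients, also covers the terminating series, where
  \<open>a\<close> or \<open>b\<close> is in \<open>- \<nat>\<close>.
\<close>
lemma fps_conv_radius_hypergeo_2_1:
  fixes a b c :: complex
  assumes "- c \<notin> \<nat>"
  shows "fps_conv_radius (fps_hypergeo [a, b] [c] 1) \<ge> 1"
  unfolding fps_conv_radius_def
proof (rule conv_radius_geI_ex')
  fix r :: real
  assume r: "0 < r" "ereal r < 1"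
  then have "r < 1" by (simp add: one_ereal_def)
  define F where "F = fps_hypergeo [a, b] [c] 1"
  define q where "q = (\<lambda>n. (a + of_nat n) / (c + of_nat n) * ((b + of_nat n) / (1 + of_nat n)))"
  have nz: "c + of_nat n \<noteq> 0" for n
    using assms by (metis add.inverse_unique of_nat_in_Nats)
  have quot: "(\<lambda>n. (x + of_nat n) / (y + of_nat n)) \<longlonglongrightarrow> 1"
    if y: "\<And>n. y + of_nat n \<noteq> 0" for x y :: complex
  proof -
    have "filterlim (\<lambda>n. y + of_nat n) at_infinity sequentially"
      by (intro tendsto_add_filterlim_at_infinity[OF tendsto_const] tendsto_of_nat)
    then have "(\<lambda>n. 1 + (x - y) / (y + of_nat n)) \<longlonglongrightarrow> 1 + 0"
      by (intro tendsto_add tendsto_const tendsto_divide_0[OF tendsto_const])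
    moreover have "1 + (x - y) / (y + of_nat n) = (x + of_nat n) / (y + of_nat n)" for n
      using y[of n] by (simp add: field_simps)
    ultimately show ?thesis by simp
  qed
  have "1 + of_nat n \<noteq> (0::complex)" for n
    by (metis of_nat_neq_0 of_nat_Suc)
  then have "q \<longlonglongrightarrow> 1 * 1"
    unfolding q_def by (intro tendsto_mult quot nz)
  then have "(\<lambda>n. norm (q n) * r) \<longlonglongrightarrow> r"
    by (auto intro!: tendsto_eq_intros)
  moreover obtain d where d: "r < d" "d < 1"
    using \<open>r < 1\<close> dense by blast
  ultimately have "\<forall>\<^sub>F n in sequentially. norm (q n) * r < d"
    by (simp add: order_tendstoD)
  then obtain N where N: "\<And>n. n \<ge> N \<Longrightarrow> norm (q n) * r < d"
    by (auto simp: eventually_sequentially)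
  have step: "fps_nth F (Suc n) = q n * fps_nth F n" for n
    by (simp add: F_def q_def fps_hypergeo_rec del: fps_hypergeo_nth)
  show "summable (\<lambda>n. fps_nth (fps_hypergeo [a, b] [c] 1) n * of_real r ^ n)"
    unfolding F_def[symmetric]
  proof (rule summable_ratio_test[OF \<open>d < 1\<close>])
    fix n assume "n \<ge> N"
    have "norm (fps_nth F (Suc n) * of_real r ^ Suc n) =
        (norm (q n) * r) * norm (fps_nth F n * of_real r ^ n)"
      using r(1) by (simp add: step norm_mult norm_power)
    also have "\<dots> \<le> d * norm (fps_nth F n * of_real r ^ n)"
      using N[OF \<open>n \<ge> N\<close>] by (intro mult_right_mono) auto
    finally show "norm (fps_nth F (Suc n) * of_real r ^ Suc n) \<le> d * norm (fps_nth F n * of_real r ^ n)" .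
  qed
qed

section \<open>The square of the Gaussian hypergeometric function\<close>

theorem theorem2p1:
  fixes a b c :: complex
  assumes "- c \<notin> \<nat>"
  shows "\<exists>u :: nat \<Rightarrow> complex.
           u 0 = 1 \<and> u 1 = 2 * a * b / c \<and>
           (\<forall>n\<ge>1. 2 * c + of_nat n - 1 \<noteq> 0 \<longrightarrow>
              u (n + 1) = alpha0 a b c n * u n + alpha1 a b c n * u (n - 1)) \<and>
           (\<forall>z. norm z < 1 \<longrightarrow> (\<lambda>n. u n * z ^ n) sums (gauss_F a b c z)\<^sup>2)"
proof (intro exI conjI allI impI)
  define F where "F = fps_hypergeo [a, b] [c] 1"
  let ?u = "fps_nth (F ^ 2)"
  show "?u 0 = 1"
    by (simp add: F_def power2_eq_square)
  show "?u 1 = 2 * a * b / c"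
    by (simp add: F_def power2_eq_square fps_mult_nth)
  show "?u (n + 1) = alpha0 a b c n * ?u n + alpha1 a b c n * ?u (n - 1)"
    if "n \<ge> 1" and "2 * c + of_nat n - 1 \<noteq> 0" for n
  proof -
    define D where "D = (of_nat n + 1) * (c + of_nat n) * (2 * c + of_nat n - 1)"
    have "of_nat n + 1 \<noteq> (0::complex)"
      by (metis of_nat_neq_0 of_nat_Suc add.commute)
    moreover have "c + of_nat n \<noteq> 0"
      using assms by (metis add.inverse_unique of_nat_in_Nats)
    ultimately have "D \<noteq> 0"
      using that(2) by (simp add: D_def)
    then have solve: "x = A / D * y + - (B / D) * y'" if "D * x = A * y - B * y'" for A B x y y'
      using that by (simp add: field_simps)
    show ?thesis
      using hypergeo_square_rec[OF assms that(1), of a b]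
      unfolding alpha0_def alpha1_def F_def[symmetric] D_def[symmetric] by (rule solve)
  qed
  show "(\<lambda>n. ?u n * z ^ n) sums (gauss_F a b c z)\<^sup>2" if "norm z < 1" for z
  proof -
    have radius: "ereal (norm z) < fps_conv_radius F"
      using that fps_conv_radius_hypergeo_2_1[OF assms, of a b]
      by (metis F_def less_le_trans ereal_less(3))
    then have "ereal (norm z) < fps_conv_radius (F ^ 2)"
      by (rule less_le_trans[OF _ fps_conv_radius_power])
    then have "(\<lambda>n. ?u n * z ^ n) sums eval_fps (F ^ 2) z"
      by (rule sums_eval_fps)
    also have "eval_fps (F ^ 2) z = (gauss_F a b c z)\<^sup>2"
      using radius by (simp add: eval_fps_power gauss_F_eq_eval_fps_hypergeo F_def)
    finally show ?thesis .
  qed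
qed

end
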